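(* Let $k$ be a field of characteristic zero and let $P$ be a Poisson algebra over $k$ with associative commutative multiplication $ab$ and Lie multiplication $\{a,b\}$. Define a new multiplication on $P$ by $a*b=ab+\{a,b\}$. Then $(P,* )$ is a conservative algebra.
   Context: A Poisson algebra is a vector space with an associative commutative bilinear multiplication $ab$ and a Lie bracket $\{a,b\}$ satisfying $\{ab,c\}=a\{b,c\}+\{a,c\}b$ (no unit is assumed). For a linear map $T$ and a bilinear map $B$ on a vector space put $[T,B](x,y)=T(B(x,y))-B(T(x),y)-B(x,T(y))$; this is again a bilinear map. An algebra with underlying vector space $V$, multiplication $\mu$ and left multiplications $L_a(x)=\mu(a,x)$ is called conservative if there exists a bilinear multiplication $F:V\times V\to V$ such that $[L_b,[L_a,\mu]]=-[L_{F(a,b)},\mu]$ for all $a,b\in V$. *)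

theory Defs
  imports Complex_Main
begin

definition bilinear_mult ::
    "('k::field \<Rightarrow> 'v::ab_group_add \<Rightarrow> 'v) \<Rightarrow> ('v \<Rightarrow> 'v \<Rightarrow> 'v) \<Rightarrow> bool" where
  "bilinear_mult scale B \<longleftrightarrow>
     (\<forall>x. Vector_Spaces.linear scale scale (B x)) \<and>
     (\<forall>y. Vector_Spaces.linear scale scale (\<lambda>x. B x y))"

locale poisson_algebra = vector_space scale
  for scale :: "'k::field \<Rightarrow> 'v::ab_group_add \<Rightarrow> 'v" +
  fixes mult :: "'v \<Rightarrow> 'v \<Rightarrow> 'v"
    and bracket :: "'v \<Rightarrow> 'v \<Rightarrow> 'v"
  assumes mult_bilinear: "bilinear_mult scale mult"
    and mult_assoc: "mult (mult a b) c = mult a (mult b c)"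
    and mult_commute: "mult a b = mult b a"
    and bracket_bilinear: "bilinear_mult scale bracket"
    and bracket_self: "bracket a a = 0"
    and jacobi: "bracket a (bracket b c) + bracket b (bracket c a) + bracket c (bracket a b) = 0"
    and leibniz: "bracket (mult a b) c = mult a (bracket b c) + mult (bracket a c) b"

definition map_bracket ::
    "('v::ab_group_add \<Rightarrow> 'v) \<Rightarrow> ('v \<Rightarrow> 'v \<Rightarrow> 'v) \<Rightarrow> 'v \<Rightarrow> 'v \<Rightarrow> 'v" where
  "map_bracket T B x y = T (B x y) - B (T x) y - B x (T y)"

text \<open>The left multiplication by \<open>a\<close> is the partial application \<open>\<mu> a\<close>.\<close>

definition conservative ::
    "('k::field \<Rightarrow> 'v::ab_group_add \<Rightarrow> 'v) \<Rightarrow> ('v \<Rightarrow> 'v \<Rightarrow> 'v) \<Rightarrow> bool" where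
  "conservative scale \<mu> \<longleftrightarrow>
     vector_space scale \<and> bilinear_mult scale \<mu> \<and>
     (\<exists>F. bilinear_mult scale F \<and>
       (\<forall>a b x y. map_bracket (\<mu> b) (map_bracket (\<mu> a) \<mu>) x y
                   = - map_bracket (\<mu> (F a b)) \<mu> x y))"

end

theory Submission
  imports Defs
begin

text \<open>
  The multiplication \<open>F\<close> that witnesses conservativity is \<open>*\<close> itself. Write \<open>L\<^sub>a = M\<^sub>a + D\<^sub>a\<close>,
  where \<open>M\<^sub>a\<close> is multiplication by \<open>a\<close> and \<open>D\<^sub>a = {a, \<cdot>}\<close>. Since \<open>D\<^sub>a\<close> is a derivation of both
  products (Leibniz and Jacobi), \<open>[D\<^sub>a, *] = 0\<close>, and hence \<open>[L\<^sub>a, *] = [M\<^sub>a, *] = -G\<^sub>a\<close>, where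
  \<open>G\<^sub>a(x, y) = axy + a{x,y} + x{a,y} - y{a,x}\<close> is linear in \<open>a\<close>.

  The family \<open>G\<close> is carried to itself by both parts of \<open>L\<^sub>b\<close>. As \<open>G\<^sub>a\<close> is a polynomial in \<open>a, x, y\<close>
  built from the two products, the derivation \<open>D\<^sub>b\<close> acts on it through \<open>a\<close> alone, so that
  \<open>[D\<^sub>b, G\<^sub>a] = G\<^bsub>{b,a}\<^esub>\<close> (\<open>map_bracket_bracket_defect\<close>); and a direct expansion gives
  \<open>[M\<^sub>b, G\<^sub>a] = -G\<^bsub>ab\<^esub>\<close> (\<open>map_bracket_mult_defect\<close>). Therefore
  \<open>[L\<^sub>b, [L\<^sub>a, *]] = -[L\<^sub>b, G\<^sub>a] = G\<^bsub>ab + {a,b}\<^esub> = -[L\<^bsub>a*b\<^esub>, *]\<close>.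
\<close>

lemma map_bracket_plus_uminus:
  "map_bracket (\<lambda>x. S x + T x) (\<lambda>x y. - B x y) x y
     = - map_bracket S B x y - map_bracket T B x y"
  if "\<And>u. S (- u) = - S u" "\<And>u. T (- u) = - T u"
    and "\<And>u v y. B (u + v) y = B u y + B v y" "\<And>x u v. B x (u + v) = B x u + B x v"
  using that by (simp add: map_bracket_def algebra_simps)

lemma bilinear_mult_additive:
  assumes "bilinear_mult scale B"
  shows "B (x + y) z = B x z + B y z" "B z (x + y) = B z x + B z y"
    "B (- x) z = - B x z" "B z (- x) = - B z x"
    "B (x - y) z = B x z - B y z" "B z (x - y) = B z x - B z y"
proof -
  interpret left: Vector_Spaces.linear scale scale "\<lambda>x. B x z"
    using assms by (simp add: bilinear_mult_def)
  interpret right: Vector_Spaces.linear scale scale "B z"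
    using assms by (simp add: bilinear_mult_def)
  show "B (x + y) z = B x z + B y z" "B z (x + y) = B z x + B z y"
    "B (- x) z = - B x z" "B z (- x) = - B z x"
    "B (x - y) z = B x z - B y z" "B z (x - y) = B z x - B z y"
    by (simp_all add: left.add right.add left.neg right.neg left.diff right.diff)
qed

lemma bilinear_mult_plus:
  assumes "vector_space scale" "bilinear_mult scale B" "bilinear_mult scale C"
  shows "bilinear_mult scale (\<lambda>x y. B x y + C x y)"
proof -
  interpret vector_space_pair scale scale
    using assms(1) by (simp add: vector_space_pair_def)
  show ?thesis
    using assms(2,3) by (auto simp: bilinear_mult_def intro!: linear_compose_add)
qed

context poisson_algebra
begin

lemmas mult_additive = bilinear_mult_additive[OF mult_bilinear]
lemmas bracket_additive = bilinear_mult_additive[OF bracket_bilinear]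

lemma mult_left_commute: "mult a (mult b c) = mult b (mult a c)"
  by (metis mult_assoc mult_commute)

lemmas mult_ac = mult_assoc mult_commute mult_left_commute

lemma bracket_antisym: "bracket x y = - bracket y x"
proof -
  have "0 = bracket (x + y) (x + y)"
    by (simp add: bracket_self)
  also have "\<dots> = bracket x y + bracket y x"
    by (simp only: bracket_additive) (simp add: bracket_self)
  finally show ?thesis
    unfolding eq_neg_iff_add_eq_0 by (rule sym)
qed

lemma bracket_mult_right: "bracket c (mult x y) = mult (bracket c x) y + mult x (bracket c y)"
  using leibniz[of x y c] bracket_antisym[of "mult x y" c] bracket_antisym[of x c]
    bracket_antisym[of y c]
  by (simp add: mult_additive add.commute minus_equation_iff[of "bracket c (mult x y)"])

lemma bracket_bracket_right:
  "bracket c (bracket x y) = bracket (bracket c x) y + bracket x (bracket c y)"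
  using jacobi[of c x y] bracket_antisym[of y c] bracket_antisym[of y "bracket c x"]
  by (simp add: bracket_additive algebra_simps)

definition star :: "'v \<Rightarrow> 'v \<Rightarrow> 'v" where
  "star a b = mult a b + bracket a b"

text \<open>The form \<open>G\<^sub>a\<close>: up to sign, the failure of \<open>L\<^sub>a\<close> to be a derivation of \<open>*\<close>.\<close>

definition defect :: "'v \<Rightarrow> 'v \<Rightarrow> 'v \<Rightarrow> 'v" where
  "defect a x y = mult a (mult x y) + mult a (bracket x y) + mult x (bracket a y)
     - mult y (bracket a x)"

lemma defect_additive:
  "defect a (x + z) y = defect a x y + defect a z y"
  "defect a x (y + z) = defect a x y + defect a x z"
  "defect (a - b) x y = defect a x y - defect b x y"
  by (simp_all add: defect_def mult_additive bracket_additive algebra_simps)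

text \<open>Only multiplication by \<open>a\<close> contributes, because \<open>{a, \<cdot>}\<close> is a derivation of \<open>*\<close>.\<close>

lemma map_bracket_star: "map_bracket (star a) star = (\<lambda>x y. - defect a x y)"
proof (intro ext)
  fix x y
  have bracket_part: "bracket a (star x y) = star (bracket a x) y + star x (bracket a y)"
    by (simp add: star_def bracket_additive bracket_mult_right bracket_bracket_right[of a]
        algebra_simps)
  have mult_part: "mult a (star x y) - star (mult a x) y - star x (mult a y) = - defect a x y"
    by (simp add: star_def defect_def mult_additive bracket_mult_right leibniz
        bracket_antisym[of x a] mult_ac algebra_simps)
  have "map_bracket (star a) star x y
      = (mult a (star x y) - star (mult a x) y - star x (mult a y))
        + (bracket a (star x y) - star (bracket a x) y - star x (bracket a y))"
    by (simp add: map_bracket_def star_def mult_additive bracket_additive algebra_simps)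
  then show "map_bracket (star a) star x y = - defect a x y"
    using bracket_part mult_part by simp
qed

text \<open>
  A derivation of both products differentiates the polynomial \<open>defect a x y\<close> in each of its three
  arguments; \<open>map_bracket\<close> removes the terms coming from \<open>x\<close> and \<open>y\<close>.
\<close>

lemma map_bracket_bracket_defect: "map_bracket (bracket b) (defect a) x y = defect (bracket b a) x y"
  by (simp add: map_bracket_def defect_def mult_additive bracket_additive bracket_mult_right
      bracket_bracket_right[of b] algebra_simps)

text \<open>
  The terms \<open>xy{a,b}\<close> from the two arguments cancel, since \<open>G\<^sub>a(x, y) - axy\<close> is alternating in
  \<open>x, y\<close>; the remaining mixed terms recombine by the Leibniz rule for \<open>{ab, \<cdot>}\<close>.
\<close>

lemma map_bracket_mult_defect: "map_bracket (mult b) (defect a) x y = - defect (mult a b) x y"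
  by (simp add: map_bracket_def defect_def mult_additive bracket_mult_right leibniz
      bracket_antisym[of x b] mult_ac algebra_simps)

lemma map_bracket_map_bracket_star:
  "map_bracket (star b) (map_bracket (star a) star) x y = - map_bracket (star (star a b)) star x y"
proof -
  have "map_bracket (star b) (map_bracket (star a) star) x y
      = - map_bracket (mult b) (defect a) x y - map_bracket (bracket b) (defect a) x y"
    unfolding map_bracket_star
    using map_bracket_plus_uminus[of "mult b" "bracket b" "defect a" x y]
    by (simp add: star_def[abs_def] mult_additive bracket_additive defect_additive)
  also have "\<dots> = defect (mult a b - bracket b a) x y"
    by (simp add: map_bracket_mult_defect map_bracket_bracket_defect defect_additive)
  also have "mult a b - bracket b a = star a b"
    by (simp add: star_def bracket_antisym[of a b])
  finally show ?thesis
    by (simp add: map_bracket_star)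
qed

lemma conservative_star: "conservative scale star"
proof -
  have "vector_space scale"
    by (rule vector_space_axioms)
  moreover from this have "bilinear_mult scale star"
    using bilinear_mult_plus[OF _ mult_bilinear bracket_bilinear] by (simp add: star_def[abs_def])
  ultimately show ?thesis
    unfolding conservative_def using map_bracket_map_bracket_star by blast
qed

end

theorem mainTheorem10:
  fixes scale :: "'k::field_char_0 \<Rightarrow> 'v::ab_group_add \<Rightarrow> 'v"
    and mult bracket :: "'v \<Rightarrow> 'v \<Rightarrow> 'v"
  assumes "poisson_algebra scale mult bracket"
  shows "conservative scale (\<lambda>a b. mult a b + bracket a b)"
proof -
  interpret poisson_algebra scale mult bracket
    by (rule assms)
  show ?thesis
    using conservative_star by (simp add: star_def[abs_def])
qed

end
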